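(* Let $\Omega\subset\mathbb{C}$ be an exceptional domain such that $\mathbb{C}\setminus\Omega$ is bounded, and let $u$ be its associated function. Then $|\nabla u|<1$ in $\Omega$, and $$\lim_{|z|\to\infty}\nabla u(z)=0.$$
   Context: We identify $\mathbb{R}^2$ with $\mathbb{C}$. An open set $\Omega\subset\mathbb{C}$ with non-empty boundary is a smooth domain if, for each $z_0\in\partial\Omega$, there exist $\varepsilon>0$ and a smooth diffeomorphism $\psi$ from $D(z_0,\varepsilon)$ onto an open set $D\subset\mathbb{R}^2$ such that $\psi(D(z_0,\varepsilon)\cap\Omega)=D\cap\{x_2>0\}$ and $\psi(D(z_0,\varepsilon)\cap\partial\Omega)=D\cap\{x_2=0\}$. An exceptional domain is a smooth, connected, unbounded domain $\Omega\subset\mathbb{C}$ with non-empty boundary that admits a function $u$, harmonic in $\Omega$ and $C^1$ up to the boundary, such that $u>0$ in $\Omega$, $u=0$ on $\partial\Omega$, and $|\nabla u|=1$ on $\partial\Omega$. Such a $u$ is unique, and we call it the associated function of $\Omega$. *)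

theory Defs
  imports "HOL-Analysis.Analysis"
begin

definition partial1 :: "(complex \<Rightarrow> 'b::real_normed_vector) \<Rightarrow> complex \<Rightarrow> 'b" where
  "partial1 f z = frechet_derivative f (at z) 1"

definition partial2 :: "(complex \<Rightarrow> 'b::real_normed_vector) \<Rightarrow> complex \<Rightarrow> 'b" where
  "partial2 f z = frechet_derivative f (at z) \<i>"

fun Ck_on :: "nat \<Rightarrow> complex set \<Rightarrow> (complex \<Rightarrow> 'b::real_normed_vector) \<Rightarrow> bool" where
  "Ck_on 0 U f = continuous_on U f"
| "Ck_on (Suc k) U f =
     ((\<forall>z\<in>U. f differentiable (at z)) \<and> Ck_on k U (partial1 f) \<and> Ck_on k U (partial2 f))"

definition smooth_on :: "complex set \<Rightarrow> (complex \<Rightarrow> 'b::real_normed_vector) \<Rightarrow> bool" where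
  "smooth_on U f \<longleftrightarrow> (\<forall>k. Ck_on k U f)"

definition smooth_diffeo :: "complex set \<Rightarrow> complex set \<Rightarrow> (complex \<Rightarrow> complex) \<Rightarrow> bool" where
  "smooth_diffeo U D \<psi> \<longleftrightarrow> open U \<and> open D \<and> bij_betw \<psi> U D \<and>
     smooth_on U \<psi> \<and> smooth_on D (inv_into U \<psi>)"

definition smooth_domain :: "complex set \<Rightarrow> bool" where
  "smooth_domain \<Omega> \<longleftrightarrow> open \<Omega> \<and> frontier \<Omega> \<noteq> {} \<and>
     (\<forall>z0\<in>frontier \<Omega>. \<exists>\<epsilon>>0. \<exists>\<psi> D. smooth_diffeo (ball z0 \<epsilon>) D \<psi> \<and>
        \<psi> ` (ball z0 \<epsilon> \<inter> \<Omega>) = D \<inter> {x. Im x > 0} \<and>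
        \<psi> ` (ball z0 \<epsilon> \<inter> frontier \<Omega>) = D \<inter> {x. Im x = 0})"

definition grad :: "(complex \<Rightarrow> real) \<Rightarrow> complex \<Rightarrow> complex" where
  "grad u z = Complex (partial1 u z) (partial2 u z)"

definition harmonic_on :: "complex set \<Rightarrow> (complex \<Rightarrow> real) \<Rightarrow> bool" where
  "harmonic_on \<Omega> u \<longleftrightarrow> Ck_on 2 \<Omega> u \<and>
     (\<forall>z\<in>\<Omega>. partial1 (partial1 u) z + partial2 (partial2 u) z = 0)"

text \<open>u is harmonic in Omega and C^1 up to the boundary (u and its gradient extend
  continuously to the closure), u > 0 in Omega, u = 0 and |grad u| = 1 on the boundary.\<close>
definition associated_function :: "complex set \<Rightarrow> (complex \<Rightarrow> real) \<Rightarrow> bool" where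
  "associated_function \<Omega> u \<longleftrightarrow> harmonic_on \<Omega> u \<and>
     continuous_on (closure \<Omega>) u \<and>
     (\<exists>G. continuous_on (closure \<Omega>) G \<and> (\<forall>z\<in>\<Omega>. G z = grad u z) \<and>
          (\<forall>z\<in>frontier \<Omega>. norm (G z) = 1)) \<and>
     (\<forall>z\<in>\<Omega>. u z > 0) \<and> (\<forall>z\<in>frontier \<Omega>. u z = 0)"

definition exceptional_domain :: "complex set \<Rightarrow> bool" where
  "exceptional_domain \<Omega> \<longleftrightarrow> smooth_domain \<Omega> \<and> connected \<Omega> \<and> \<not> bounded \<Omega> \<and>
     frontier \<Omega> \<noteq> {} \<and> (\<exists>u. associated_function \<Omega> u)"

end

(*
  F = u_x - i u_y is holomorphic, so by the maximum principle everything follows from F -> 0 at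
  infinity. For |z| > R the substitution z = exp w makes u the real part of a holomorphic function
  K on the half plane Re w > L = ln R, with K'(w) = F(z) z. Since Re K > 0, the Schwarz-Pick
  inequality |K'| (Re w - L) <= Re K shows that Re K / (Re w - L) is nonincreasing along horizontal
  rays, and hence that K' is bounded by the values of u on one circle; thus F(z) = O(1/|z|).
*)
theory Submission
  imports Defs "HOL-Complex_Analysis.Complex_Analysis"
begin

section \<open>Symmetry of mixed second derivatives\<close>

lemma DERIV_along_line:
  fixes f :: "'a::real_normed_vector \<Rightarrow> real"
  assumes "f differentiable (at (z + x *\<^sub>R a))"
  shows "((\<lambda>s. f (z + s *\<^sub>R a)) has_real_derivative
           frechet_derivative f (at (z + x *\<^sub>R a)) a) (at x)"
proof -
  let ?D = "frechet_derivative f (at (z + x *\<^sub>R a))"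
  have D: "(f has_derivative ?D) (at (z + x *\<^sub>R a))"
    using assms frechet_derivative_works by blast
  have "((\<lambda>s. f (z + s *\<^sub>R a)) has_derivative (\<lambda>h. ?D (h *\<^sub>R a))) (at x)"
    by (rule has_derivative_compose[where g = f and f = "\<lambda>s. z + s *\<^sub>R a", OF _ D]) (auto intro!: derivative_eq_intros)
  moreover have "?D (h *\<^sub>R a) = ?D a * h" for h
    using linear_cmul[OF has_derivative_linear[OF D]] by simp
  ultimately show ?thesis
    by (simp add: has_field_derivative_def)
qed

text \<open>Two mean value theorems: the first, along \<open>a\<close>, is applied to the difference
  of \<open>f\<close> on two opposite sides of the parallelogram; the second, along
  \<open>b\<close>, to the resulting difference of \<open>a\<close>-derivatives.\<close>

lemma second_difference_eq_mixed_derivative: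
  fixes f :: "'a::real_normed_vector \<Rightarrow> real"
  assumes "h > 0"
    and S: "\<And>s t. \<lbrakk>0 \<le> s; s \<le> h; 0 \<le> t; t \<le> h\<rbrakk> \<Longrightarrow> z + s *\<^sub>R a + t *\<^sub>R b \<in> S"
    and f: "\<And>x. x \<in> S \<Longrightarrow> f differentiable (at x)"
    and fa: "\<And>x. x \<in> S \<Longrightarrow> (\<lambda>y. frechet_derivative f (at y) a) differentiable (at x)"
  obtains s t where "0 < s" "s < h" "0 < t" "t < h"
    "f (z + h *\<^sub>R a + h *\<^sub>R b) - f (z + h *\<^sub>R a) - f (z + h *\<^sub>R b) + f z =
       h * (h * frechet_derivative (\<lambda>y. frechet_derivative f (at y) a) (at (z + s *\<^sub>R a + t *\<^sub>R b)) b)"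
proof -
  define fa where "fa = (\<lambda>y. frechet_derivative f (at y) a)"
  define g where "g = (\<lambda>s. f (z + h *\<^sub>R b + s *\<^sub>R a) - f (z + s *\<^sub>R a))"
  have "DERIV g x :> fa (z + h *\<^sub>R b + x *\<^sub>R a) - fa (z + x *\<^sub>R a)" if "0 \<le> x" "x \<le> h" for x
    unfolding g_def fa_def
    using S[of x h] S[of x 0] that \<open>h > 0\<close>
    by (intro DERIV_diff DERIV_along_line f) (auto simp: algebra_simps)
  from MVT2[OF \<open>h > 0\<close> this] obtain s where s: "0 < s" "s < h"
    "g h - g 0 = h * (fa (z + h *\<^sub>R b + s *\<^sub>R a) - fa (z + s *\<^sub>R a))"
    by auto
  have "DERIV (\<lambda>t. fa (z + s *\<^sub>R a + t *\<^sub>R b)) x :> frechet_derivative fa (at (z + s *\<^sub>R a + x *\<^sub>R b)) b"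
    if "0 \<le> x" "x \<le> h" for x
    unfolding fa_def using S[of s x] that s
    by (intro DERIV_along_line assms(4)) auto
  from MVT2[OF \<open>h > 0\<close> this] obtain t where t: "0 < t" "t < h"
    "fa (z + s *\<^sub>R a + h *\<^sub>R b) - fa (z + s *\<^sub>R a) =
       h * frechet_derivative fa (at (z + s *\<^sub>R a + t *\<^sub>R b)) b"
    by auto
  have "g h - g 0 = f (z + h *\<^sub>R a + h *\<^sub>R b) - f (z + h *\<^sub>R a) - f (z + h *\<^sub>R b) + f z"
    by (simp add: g_def algebra_simps)
  with s t show ?thesis
    by (intro that[of s t]) (simp_all add: fa_def add_ac)
qed

text \<open>The second difference over a small parallelogram is symmetric in \<open>a\<close> and
  \<open>b\<close>, so after division by the square of \<open>h\<close> it is a value of either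
  mixed derivative near \<open>z\<close>. Continuity then rules out a gap between the two at
  \<open>z\<close>.\<close>

lemma mixed_derivatives_commute:
  fixes f :: "'a::real_normed_vector \<Rightarrow> real"
  assumes "open S" "z \<in> S"
    and f: "\<And>x. x \<in> S \<Longrightarrow> f differentiable (at x)"
    and fa: "\<And>x. x \<in> S \<Longrightarrow> (\<lambda>y. frechet_derivative f (at y) a) differentiable (at x)"
    and fb: "\<And>x. x \<in> S \<Longrightarrow> (\<lambda>y. frechet_derivative f (at y) b) differentiable (at x)"
    and cab: "continuous_on S (\<lambda>x. frechet_derivative (\<lambda>y. frechet_derivative f (at y) a) (at x) b)"
    and cba: "continuous_on S (\<lambda>x. frechet_derivative (\<lambda>y. frechet_derivative f (at y) b) (at x) a)"
  shows "frechet_derivative (\<lambda>y. frechet_derivative f (at y) a) (at z) b =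
         frechet_derivative (\<lambda>y. frechet_derivative f (at y) b) (at z) a"
proof (rule ccontr)
  define p where "p = (\<lambda>x. frechet_derivative (\<lambda>y. frechet_derivative f (at y) a) (at x) b)"
  define q where "q = (\<lambda>x. frechet_derivative (\<lambda>y. frechet_derivative f (at y) b) (at x) a)"
  assume neq: "\<not> ?thesis"
  \<comment> \<open>Half the gap: no number lies within less than \<open>e\<close> of both
    \<open>p z\<close> and \<open>q z\<close>.\<close>
  define e where "e = \<bar>p z - q z\<bar> / 2"
  have "e > 0" using neq by (simp add: e_def p_def q_def)
  have "isCont p z" "isCont q z"
    using assms(1,2) cab cba by (auto simp: continuous_on_eq_continuous_at p_def q_def)
  then have "(p \<longlongrightarrow> p z) (nhds z)" "(q \<longlongrightarrow> q z) (nhds z)"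
    by (simp_all add: continuous_at tendsto_at_iff_tendsto_nhds)
  then have "\<forall>\<^sub>F x in nhds z. x \<in> S \<and> dist (p x) (p z) < e \<and> dist (q x) (q z) < e"
    using \<open>e > 0\<close> assms(1,2) by (intro eventually_conj) (auto simp: eventually_nhds_in_open tendsto_iff)
  then obtain d where "d > 0" and d: "\<And>x. dist x z < d \<Longrightarrow> x \<in> S \<and> dist (p x) (p z) < e \<and> dist (q x) (q z) < e"
    by (auto simp: eventually_nhds_metric)
  \<comment> \<open>Small enough for the parallelogram spanned by \<open>h *\<^sub>R a\<close> and
    \<open>h *\<^sub>R b\<close> at \<open>z\<close> to lie within distance \<open>d\<close> of
    \<open>z\<close>. The summand 1 keeps the denominator positive when \<open>a\<close> and
    \<open>b\<close> vanish.\<close>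
  define h where "h = d / (norm a + norm b + 1)"
  have "h > 0" and h: "h * (norm a + norm b) < d"
    using \<open>d > 0\<close> by (auto simp: h_def field_simps add_pos_nonneg add_nonneg_pos)
  have near: "dist (z + s *\<^sub>R a + t *\<^sub>R b) z < d" if "0 \<le> s" "s \<le> h" "0 \<le> t" "t \<le> h" for s t
  proof -
    have "norm (s *\<^sub>R a + t *\<^sub>R b) \<le> norm (s *\<^sub>R a) + norm (t *\<^sub>R b)"
      by (rule norm_triangle_ineq)
    also have "\<dots> \<le> h * norm a + h * norm b"
      using that by (auto intro!: add_mono mult_right_mono)
    also have "\<dots> < d" using h by (simp add: algebra_simps)
    finally show ?thesis by (simp add: dist_norm add.assoc)
  qed
  obtain s t where st: "0 < s" "s < h" "0 < t" "t < h"
    "f (z + h *\<^sub>R a + h *\<^sub>R b) - f (z + h *\<^sub>R a) - f (z + h *\<^sub>R b) + f z =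
       h * (h * p (z + s *\<^sub>R a + t *\<^sub>R b))"
    unfolding p_def
    by (rule second_difference_eq_mixed_derivative[of h z a b S f]) (use \<open>h > 0\<close> f fa near d in auto)
  have near': "dist (z + s *\<^sub>R b + t *\<^sub>R a) z < d" if "0 \<le> s" "s \<le> h" "0 \<le> t" "t \<le> h" for s t
    using near[OF that(3,4,1,2)] by (simp add: add_ac)
  obtain s' t' where st': "0 < s'" "s' < h" "0 < t'" "t' < h"
    "f (z + h *\<^sub>R b + h *\<^sub>R a) - f (z + h *\<^sub>R b) - f (z + h *\<^sub>R a) + f z =
       h * (h * q (z + s' *\<^sub>R b + t' *\<^sub>R a))"
    unfolding q_def
    by (rule second_difference_eq_mixed_derivative[of h z b a S f]) (use \<open>h > 0\<close> f fb near' d in auto)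
  have "p (z + s *\<^sub>R a + t *\<^sub>R b) = q (z + s' *\<^sub>R b + t' *\<^sub>R a)"
  proof -
    have "z + h *\<^sub>R b + h *\<^sub>R a = z + h *\<^sub>R a + h *\<^sub>R b"
      by (simp add: add_ac)
    then have "f (z + h *\<^sub>R b + h *\<^sub>R a) = f (z + h *\<^sub>R a + h *\<^sub>R b)"
      by (rule arg_cong)
    then have "h * (h * p (z + s *\<^sub>R a + t *\<^sub>R b)) = h * (h * q (z + s' *\<^sub>R b + t' *\<^sub>R a))"
      using st(5) st'(5) by linarith
    then show ?thesis using \<open>h > 0\<close> by simp
  qed
  moreover have "dist (p (z + s *\<^sub>R a + t *\<^sub>R b)) (p z) < e"
    using d near st by simp
  moreover have "dist (q (z + s' *\<^sub>R b + t' *\<^sub>R a)) (q z) < e"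
    using d near' st' by simp
  ultimately show False
    by (simp add: e_def dist_real_def abs_if split: if_splits)
qed

section \<open>The conjugate gradient of a harmonic function\<close>

text \<open>The Cauchy-Riemann equations for u_x - i u_y are Laplace's equation and the symmetry of
  the mixed derivatives.\<close>

lemma harmonic_on_gradient_holomorphic:
  assumes "open S" "harmonic_on S u"
  shows "(\<lambda>z. cnj (grad u z)) holomorphic_on S"
proof (rule holomorphic_onI)
  fix z assume z: "z \<in> S"
  have C2: "Ck_on (Suc (Suc 0)) S u"
    using assms(2) by (simp add: harmonic_on_def numeral_2_eq_2)
  have p1: "partial1 = (\<lambda>(f::complex \<Rightarrow> real) z. frechet_derivative f (at z) 1)"
    and p2: "partial2 = (\<lambda>(f::complex \<Rightarrow> real) z. frechet_derivative f (at z) \<i>)"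
    by (simp_all add: fun_eq_iff partial1_def partial2_def)
  have mixed: "partial2 (partial1 u) z = partial1 (partial2 u) z"
    unfolding p1 p2
    by (rule mixed_derivatives_commute[OF assms(1) z]) (use C2 in \<open>simp_all add: p1 p2\<close>)
  define m where "m = partial1 (partial2 u) z"
  define k where "k = partial1 (partial1 u) z"
  have laplace: "partial2 (partial2 u) z = - k"
    using assms(2) z by (simp add: harmonic_on_def k_def add_eq_0_iff)
  have lin: "D x = Re x * D 1 + Im x * D \<i>" if "linear D" for D :: "complex \<Rightarrow> real" and x
  proof -
    have "x = Re x *\<^sub>R 1 + Im x *\<^sub>R \<i>" by (simp add: complex_eq_iff)
    then have "D x = D (Re x *\<^sub>R 1 + Im x *\<^sub>R \<i>)" by simp
    also have "\<dots> = Re x * D 1 + Im x * D \<i>"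
      using that by (simp add: linear_add linear_cmul)
    finally show ?thesis .
  qed
  have D1: "(partial1 u has_derivative frechet_derivative (partial1 u) (at z)) (at z)"
    and D2: "(partial2 u has_derivative frechet_derivative (partial2 u) (at z)) (at z)"
    using C2 z by (auto simp: frechet_derivative_works[symmetric])
  have "((\<lambda>z. of_real (partial1 u z) - \<i> * of_real (partial2 u z)) has_derivative
      (\<lambda>x. of_real (frechet_derivative (partial1 u) (at z) x) -
           \<i> * of_real (frechet_derivative (partial2 u) (at z) x))) (at z)"
    by (intro derivative_intros D1 D2)
  moreover have "(\<lambda>z. of_real (partial1 u z) - \<i> * of_real (partial2 u z)) = (\<lambda>z. cnj (grad u z))"
    by (simp add: fun_eq_iff grad_def complex_eq_iff)
  \<comment> \<open>The real differential is multiplication by the complex number u_xx - i u_xy,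
    which is complex differentiability.\<close>
  moreover have "complex_of_real (frechet_derivative (partial1 u) (at z) x) -
           \<i> * of_real (frechet_derivative (partial2 u) (at z) x) = Complex k (- m) * x" for x
    using lin[OF has_derivative_linear[OF D1], of x] lin[OF has_derivative_linear[OF D2], of x]
      mixed laplace
    by (simp add: partial1_def[symmetric] partial2_def[symmetric] k_def[symmetric] m_def[symmetric]
        complex_eq_iff algebra_simps)
  ultimately have "((\<lambda>z. cnj (grad u z)) has_field_derivative Complex k (- m)) (at z)"
    by (simp add: has_field_derivative_def)
  then show "(\<lambda>z. cnj (grad u z)) field_differentiable at z within S"
    using field_differentiable_at_within field_differentiable_def by blast
qed

section \<open>Holomorphic functions with positive real part on a half plane\<close>

text \<open>Moebius maps on both sides of \<open>H\<close> turn it into a self-map \<open>g\<close>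
  of the unit disc fixing 0, and the Schwarz lemma bounds \<open>deriv g 0\<close>.\<close>

lemma Schwarz_Pick_half_plane:
  assumes holH: "H holomorphic_on {w. Re w > L}"
    and pos: "\<And>w. Re w > L \<Longrightarrow> Re (H w) > 0"
    and w: "Re w > L"
  shows "norm (deriv H w) * (Re w - L) \<le> Re (H w)"
proof -
  define r where "r = Re w - L"
  have "r > 0" using w by (simp add: r_def)
  \<comment> \<open>The Cayley map of the disc to the right half plane, scaled by \<open>r\<close>
    and shifted by \<open>w - r\<close>, whose real part is \<open>L\<close>; it sends 0 to
    \<open>w\<close>.\<close>
  define \<phi> where "\<phi> = (\<lambda>\<zeta>. w - of_real r + of_real r * ((1 + \<zeta>) / (1 - \<zeta>)))"
  define c where "c = H w"
  have Rec: "Re c > 0" using pos w by (simp add: c_def)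
  \<comment> \<open>The outer map sends the right half plane into the disc and \<open>c\<close> to
    0.\<close>
  define g where "g = (\<lambda>\<zeta>. (H (\<phi> \<zeta>) - c) / (H (\<phi> \<zeta>) + cnj c))"
  have \<phi>: "Re (\<phi> \<zeta>) > L" if "norm \<zeta> < 1" for \<zeta>
  proof -
    have "1 - \<zeta> \<noteq> 0" using that by auto
    have "Re ((1 + \<zeta>) / (1 - \<zeta>)) = (1 - (norm \<zeta>)\<^sup>2) / (norm (1 - \<zeta>))\<^sup>2"
      by (simp add: Re_divide cmod_power2) (simp add: algebra_simps power2_eq_square)
    also have "\<dots> > 0"
      using that \<open>1 - \<zeta> \<noteq> 0\<close> by (simp add: power_less_one_iff abs_square_less_1)
    finally have "r * Re ((1 + \<zeta>) / (1 - \<zeta>)) > 0" using \<open>r > 0\<close> by simp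
    moreover have "Re (\<phi> \<zeta>) = Re w - r + r * Re ((1 + \<zeta>) / (1 - \<zeta>))"
      unfolding \<phi>_def by (simp only: plus_complex.sel minus_complex.sel times_complex.sel Re_complex_of_real Im_complex_of_real mult_zero_left diff_zero)
    ultimately show ?thesis by (simp add: r_def)
  qed
  have [simp]: "\<phi> 0 = w" by (simp add: \<phi>_def)
  have "\<phi> holomorphic_on ball 0 1"
    unfolding \<phi>_def by (intro holomorphic_intros) auto
  then have holH\<phi>: "(\<lambda>\<zeta>. H (\<phi> \<zeta>)) holomorphic_on ball 0 1"
    using holomorphic_on_compose_gen[OF _ holH, of \<phi> "ball 0 1"] \<phi> by (simp add: o_def image_subset_iff)
  have nz: "H (\<phi> \<zeta>) + cnj c \<noteq> 0" if "norm \<zeta> < 1" for \<zeta>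
    using pos[OF \<phi>[OF that]] Rec by (auto simp: complex_eq_iff)
  have "g holomorphic_on ball 0 1"
    unfolding g_def using nz by (intro holomorphic_intros holH\<phi>) auto
  moreover have "g 0 = 0" by (simp add: g_def c_def)
  moreover have "norm (g \<zeta>) < 1" if "norm \<zeta> < 1" for \<zeta>
  proof -
    \<comment> \<open>The two squares differ by four times the product of the real parts of
      \<open>H (\<phi> \<zeta>)\<close> and \<open>c\<close>.\<close>
    have "(norm (H (\<phi> \<zeta>) - c))\<^sup>2 < (norm (H (\<phi> \<zeta>) + cnj c))\<^sup>2"
      using mult_pos_pos[OF pos[OF \<phi>[OF that]] Rec]
      by (simp add: cmod_power2) (simp add: algebra_simps power2_eq_square)
    then have "norm (H (\<phi> \<zeta>) - c) < norm (H (\<phi> \<zeta>) + cnj c)"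
      by (rule power_less_imp_less_base) simp
    then show ?thesis using nz[OF that] by (simp add: g_def norm_divide)
  qed
  ultimately have le: "norm (deriv g 0) \<le> 1"
    using Schwarz_Lemma(2)[of g 0] by simp
  have H': "(H has_field_derivative deriv H w) (at (\<phi> 0))"
    using holomorphic_derivI[OF holH open_halfspace_Re_gt] w by simp
  have "(\<phi> has_field_derivative 2 * of_real r) (at 0)"
    unfolding \<phi>_def by (auto intro!: derivative_eq_intros)
  then have D: "((\<lambda>\<zeta>. H (\<phi> \<zeta>)) has_field_derivative deriv H w * (2 * of_real r)) (at 0)"
    using DERIV_chain2 H' by blast
  have cc: "c + cnj c = of_real (2 * Re c)" by (simp add: complex_eq_iff)
  have "(g has_field_derivative (deriv H w * (2 * of_real r)) / (c + cnj c)) (at 0)"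
    unfolding g_def using nz[of 0]
    by (auto intro!: derivative_eq_intros D simp: c_def)
  \<comment> \<open>The factor 2 from the derivative of \<open>\<phi>\<close> cancels the one in
    \<open>c + cnj c\<close>.\<close>
  then have "deriv g 0 = deriv H w * of_real r / of_real (Re c)"
    unfolding cc by (simp add: DERIV_imp_deriv)
  then have "norm (deriv g 0) = norm (deriv H w) * r / Re c"
    using Rec \<open>r > 0\<close> by (simp add: norm_mult norm_divide)
  with le show ?thesis
    using Rec by (simp add: r_def c_def field_simps)
qed

text \<open>Schwarz-Pick serves twice: it bounds the derivative at \<open>w\<close> by the quotient
  \<open>k (Re w)\<close>, and it makes \<open>k\<close> nonincreasing. The bound thus moves back to
  the abscissa \<open>s\<close>, which can be chosen independently of \<open>w\<close>.\<close>

lemma half_plane_positive_deriv_bound: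
  assumes holH: "H holomorphic_on {w. Re w > L}"
    and pos: "\<And>w. Re w > L \<Longrightarrow> Re (H w) > 0"
    and s: "L < s" "s \<le> Re w"
  shows "norm (deriv H w) \<le> Re (H (Complex s (Im w))) / (s - L)"
proof -
  define k where "k = (\<lambda>x. Re (H (Complex x (Im w))) / (x - L))"
  have "k s \<ge> k (Re w)"
  proof (rule DERIV_nonpos_imp_nonincreasing[OF s(2)])
    fix x assume x: "s \<le> x" "x \<le> Re w"
    let ?d = "deriv H (Complex x (Im w))"
    have "(H has_field_derivative ?d) (at (Complex x (Im w)))"
      using holomorphic_derivI[OF holH open_halfspace_Re_gt] x s by simp
    moreover have "((\<lambda>x. Complex x (Im w)) has_derivative (\<lambda>h. of_real h)) (at x)"
      unfolding Complex_eq by (auto intro!: derivative_eq_intros)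
    ultimately have "((\<lambda>x. H (Complex x (Im w))) has_derivative (\<lambda>h. ?d * of_real h)) (at x)"
      unfolding has_field_derivative_def by (rule has_derivative_compose[rotated])
    from has_derivative_Re[OF this]
    have D: "((\<lambda>x. Re (H (Complex x (Im w)))) has_real_derivative Re ?d) (at x)"
      by (simp add: has_field_derivative_def)
    have "Re ?d * (x - L) \<le> norm ?d * (x - L)"
      using x s by (intro mult_right_mono complex_Re_le_cmod) auto
    also have "\<dots> \<le> Re (H (Complex x (Im w)))"
      using Schwarz_Pick_half_plane[OF holH pos, of "Complex x (Im w)"] x s by simp
    \<comment> \<open>The numerator is that of the quotient rule for \<open>k\<close>.\<close>
    finally have "(Re ?d * (x - L) - Re (H (Complex x (Im w))) * 1) / ((x - L) * (x - L)) \<le> 0"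
      by (simp add: divide_nonpos_nonneg)
    moreover have "DERIV k x :> (Re ?d * (x - L) - Re (H (Complex x (Im w))) * 1) / ((x - L) * (x - L))"
      unfolding k_def using x s by (intro DERIV_divide D) (auto intro!: derivative_eq_intros)
    ultimately show "\<exists>y. DERIV k x :> y \<and> y \<le> 0" by blast
  qed
  moreover have "norm (deriv H w) \<le> k (Re w)"
    using Schwarz_Pick_half_plane[OF holH pos, of w] s by (simp add: k_def pos_le_divide_eq)
  ultimately show ?thesis by (simp add: k_def)
qed

section \<open>Decay of the gradient outside a disc\<close>

text \<open>The differential of \<open>u\<close> is the real part of multiplication by
  \<open>cnj (grad u)\<close>, so composition with a holomorphic \<open>f\<close> obeys a complex
  chain rule. This identifies \<open>u\<close> composed with \<open>exp\<close> as the real part of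
  a primitive.\<close>

lemma DERIV_compose_real_differentiable:
  fixes u :: "complex \<Rightarrow> real"
  assumes "u differentiable (at (f w))" "(f has_field_derivative f') (at w)"
  shows "((\<lambda>w. u (f w)) has_derivative (\<lambda>h. Re (cnj (grad u (f w)) * f' * h))) (at w)"
proof -
  let ?D = "frechet_derivative u (at (f w))"
  have D: "(u has_derivative ?D) (at (f w))"
    using assms(1) frechet_derivative_works by blast
  have "?D x = Re (cnj (grad u (f w)) * x)" for x
  proof -
    have "?D x = ?D (Re x *\<^sub>R 1 + Im x *\<^sub>R \<i>)"
      by (rule arg_cong[where f = ?D]) (simp add: complex_eq_iff)
    also have "\<dots> = Re x * ?D 1 + Im x * ?D \<i>"
      using has_derivative_linear[OF D] by (simp only: linear_add linear_cmul real_scaleR_def)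
    finally show ?thesis by (simp add: grad_def partial1_def partial2_def)
  qed
  then show ?thesis
    using has_derivative_compose[OF assms(2)[unfolded has_field_derivative_def] D]
    by (simp add: mult.assoc)
qed

text \<open>On the exterior of a disc \<open>u\<close> may lack a single-valued harmonic conjugate,
  as ln |z| does. The exponential lifts the problem to a half plane, where a primitive exists and
  positivity of \<open>u\<close> gives the derivative bound.\<close>

lemma positive_harmonic_exterior_grad_bound:
  assumes "open S" "harmonic_on S u" "\<And>z. z \<in> S \<Longrightarrow> u z > 0"
    and "R > 0" and ext: "\<And>z. norm z > R \<Longrightarrow> z \<in> S"
  obtains C R' where "\<And>z. norm z \<ge> R' \<Longrightarrow> norm (grad u z) \<le> C / norm z"
proof -
  define L where "L = ln R"
  define P where "P = {w. Re w > L}"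
  define F where "F = (\<lambda>z. cnj (grad u z))"
  have expP: "exp w \<in> S" if "w \<in> P" for w
  proof -
    have "exp (Re w) > R" using that \<open>R > 0\<close>
      by (metis L_def P_def exp_less_cancel_iff exp_ln mem_Collect_eq)
    then show ?thesis by (intro ext) simp
  qed
  have "open P" "convex P" by (auto simp: P_def open_halfspace_Re_gt convex_halfspace_Re_gt)
  have "F holomorphic_on S"
    unfolding F_def by (rule harmonic_on_gradient_holomorphic) fact+
  then have "(\<lambda>w. F (exp w) * exp w) holomorphic_on P"
    using expP by (intro holomorphic_intros holomorphic_on_compose_gen[of exp P F S, unfolded o_def]) auto
  then obtain H where "\<And>w. w \<in> P \<Longrightarrow> (H has_field_derivative F (exp w) * exp w) (at w within P)"
    using holomorphic_convex_primitive'[OF \<open>convex P\<close> \<open>open P\<close>] by blast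
  then have H: "(H has_field_derivative F (exp w) * exp w) (at w)" if "w \<in> P" for w
    using that \<open>open P\<close> by (metis at_within_open)
  have diffu: "u differentiable (at z)" if "z \<in> S" for z
    using assms(2) that by (simp add: harmonic_on_def numeral_2_eq_2)
  have "((\<lambda>w. u (exp w) - Re (H w)) has_derivative (\<lambda>h. 0)) (at w within P)" if "w \<in> P" for w
  proof -
    have 1: "((\<lambda>w. u (exp w)) has_derivative (\<lambda>h. Re (F (exp w) * exp w * h))) (at w)"
      unfolding F_def by (intro DERIV_compose_real_differentiable diffu expP that DERIV_exp)
    have 2: "((\<lambda>w. Re (H w)) has_derivative (\<lambda>h. Re (F (exp w) * exp w * h))) (at w)"
      using H[OF that] unfolding has_field_derivative_def by (rule has_derivative_Re)
    show ?thesis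
      using has_derivative_at_withinI[OF has_derivative_diff[OF 1 2], of P] by (simp only: diff_self)
  qed
  from has_derivative_zero_constant[OF \<open>convex P\<close> this]
  obtain c where c: "\<And>w. w \<in> P \<Longrightarrow> u (exp w) - Re (H w) = c" by blast
  \<comment> \<open>The shift makes the real part equal to \<open>u (exp w)\<close> exactly, so that
    it inherits positivity.\<close>
  define K where "K = (\<lambda>w. H w + of_real c)"
  have K: "(K has_field_derivative F (exp w) * exp w) (at w)" if "w \<in> P" for w
    unfolding K_def using H[OF that] by (auto intro!: derivative_eq_intros)
  have ReK: "Re (K w) = u (exp w)" if "w \<in> P" for w
    using c[OF that] by (simp add: K_def)
  have holK: "K holomorphic_on {w. Re w > L}"
    using K \<open>open P\<close> by (auto simp: P_def holomorphic_on_open)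
  have posK: "Re (K w) > 0" if "Re w > L" for w
    using that ReK expP assms(3) by (simp add: P_def)
  \<comment> \<open>This circle is the image under \<open>exp\<close> of the line Re w = L + 1, on
    which the derivative bound will be evaluated; compactness bounds \<open>u\<close> there.\<close>
  have "continuous_on (sphere 0 (R * exp 1)) u"
  proof (rule continuous_at_imp_continuous_on, rule ballI)
    fix z :: complex assume "z \<in> sphere 0 (R * exp 1)"
    moreover have "R * 1 < R * exp 1"
      using \<open>R > 0\<close> by (intro mult_strict_left_mono) auto
    ultimately have "z \<in> S" by (intro ext) simp
    then show "isCont u z" using diffu differentiable_imp_continuous_within by blast
  qed
  then have "bounded (u ` sphere 0 (R * exp 1))"
    by (intro compact_imp_bounded compact_continuous_image) auto
  then obtain C where C: "\<And>z. norm z = R * exp 1 \<Longrightarrow> u z \<le> C"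
    unfolding bounded_iff by (force simp: abs_le_iff)
  have "norm (grad u z) \<le> C / norm z" if z: "norm z \<ge> R * exp 1" for z
  proof -
    have "norm z > 0" using z \<open>R > 0\<close> by (meson exp_gt_zero less_le_trans mult_pos_pos)
    then have "z \<noteq> 0" by auto
    define w where "w = Ln z"
    have ew: "exp w = z" using \<open>z \<noteq> 0\<close> by (simp add: w_def)
    have "ln (R * exp 1) \<le> ln (norm z)"
      using z \<open>R > 0\<close> \<open>norm z > 0\<close> by (subst ln_le_cancel_iff) auto
    then have Rew: "L + 1 \<le> Re w"
      using \<open>R > 0\<close> \<open>z \<noteq> 0\<close> by (simp add: w_def L_def ln_mult)
    \<comment> \<open>The choice \<open>s = L + 1\<close> makes the denominator 1.\<close>
    have "norm (deriv K w) \<le> Re (K (Complex (L + 1) (Im w))) / (L + 1 - L)"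
      using Rew by (intro half_plane_positive_deriv_bound[OF holK posK]) auto
    also have "\<dots> = u (exp (Complex (L + 1) (Im w)))"
      by (simp add: ReK P_def)
    also have "\<dots> \<le> C"
      using \<open>R > 0\<close> by (intro C) (simp add: L_def exp_add)
    also have "deriv K w = F z * z"
      using K[of w] Rew ew by (simp add: P_def DERIV_imp_deriv)
    finally show ?thesis
      using \<open>norm z > 0\<close> by (simp add: norm_mult F_def pos_le_divide_eq)
  qed
  then show thesis by (rule that)
qed

section \<open>The maximum principle on the exceptional domain\<close>

theorem mainTheorem4:
  fixes \<Omega> :: "complex set" and u :: "complex \<Rightarrow> real"
  assumes "exceptional_domain \<Omega>"
    and "bounded (- \<Omega>)"
    and "associated_function \<Omega> u"
  shows "(\<forall>z\<in>\<Omega>. norm (grad u z) < 1) \<and> (grad u \<longlongrightarrow> 0) at_infinity"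
proof -
  have "open \<Omega>" "connected \<Omega>"
    using assms(1) by (auto simp: exceptional_domain_def smooth_domain_def)
  have harm: "harmonic_on \<Omega> u" and pos: "\<And>z. z \<in> \<Omega> \<Longrightarrow> u z > 0"
    using assms(3) by (auto simp: associated_function_def)
  obtain G where contG: "continuous_on (closure \<Omega>) G"
    and G: "\<And>z. z \<in> \<Omega> \<Longrightarrow> G z = grad u z" and G1: "\<And>z. z \<in> frontier \<Omega> \<Longrightarrow> norm (G z) = 1"
    using assms(3) by (auto simp: associated_function_def)
  obtain R where "R > 0" and R: "\<And>z. z \<in> - \<Omega> \<Longrightarrow> norm z \<le> R"
    using assms(2) unfolding bounded_pos by blast
  have ext: "z \<in> \<Omega>" if "norm z > R" for z using R[of z] that by force
  obtain C R' where C: "\<And>z. norm z \<ge> R' \<Longrightarrow> norm (grad u z) \<le> C / norm z"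
    using positive_harmonic_exterior_grad_bound[OF \<open>open \<Omega>\<close> harm pos \<open>R > 0\<close> ext] by metis
  have lim: "(grad u \<longlongrightarrow> 0) at_infinity"
  proof (rule Lim_null_comparison)
    show "\<forall>\<^sub>F z in at_infinity. norm (grad u z) \<le> C / norm z"
      using C by (auto simp: eventually_at_infinity)
    show "((\<lambda>z. C / norm z) \<longlongrightarrow> 0) (at_infinity :: complex filter)"
      by (intro real_tendsto_divide_at_top[OF tendsto_const] filterlim_norm_at_top)
  qed
  have hol: "(\<lambda>z. cnj (grad u z)) holomorphic_on \<Omega>"
    by (rule harmonic_on_gradient_holomorphic) fact+
  have "\<forall>\<^sub>F z in at_infinity. norm (grad u z) < 1"
    using tendstoD[OF lim, of 1] by simp
  then obtain B where B: "\<And>z. norm z \<ge> B \<Longrightarrow> norm (grad u z) < 1"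
    by (auto simp: eventually_at_infinity)
  have le1: "norm (cnj (grad u z)) \<le> 1" if "z \<in> \<Omega>" for z
  proof -
    \<comment> \<open>The ball of radius \<open>r\<close> contains \<open>z\<close>, while its
      boundary circle lies in \<Omega> (by \<open>R + 1\<close>) and where the gradient is already
      below 1 (by \<open>B\<close>).\<close>
    define r where "r = max (norm z + 1) (max B (R + 1))"
    define U where "U = \<Omega> \<inter> ball 0 r"
    have "r > 0" using \<open>R > 0\<close> by (auto simp: r_def)
    have "open U" using \<open>open \<Omega>\<close> by (auto simp: U_def)
    have "closure U \<subseteq> closure \<Omega>" unfolding U_def by (intro closure_mono) auto
    \<comment> \<open>The extension \<open>G\<close> replaces \<open>grad u\<close> because the
      maximum principle requires continuity on the closure of \<open>U\<close>.\<close>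
    have "norm (cnj (G z)) \<le> 1"
    proof (rule maximum_modulus_frontier[where S = U and f = "\<lambda>z. cnj (G z)"])
      have "(\<lambda>z. cnj (G z)) holomorphic_on U"
        using hol by (rule holomorphic_transform[OF holomorphic_on_subset]) (auto simp: U_def G)
      then show "(\<lambda>z. cnj (G z)) holomorphic_on interior U"
        using \<open>open U\<close> by (simp add: interior_open)
      show "continuous_on (closure U) (\<lambda>z. cnj (G z))"
        using \<open>closure U \<subseteq> closure \<Omega>\<close>
        by (intro continuous_intros continuous_on_subset[OF contG])
      show "bounded U" by (auto simp: U_def)
      show "z \<in> U" using that by (auto simp: U_def r_def)
      fix x assume x: "x \<in> frontier U"
      show "norm (cnj (G x)) \<le> 1"
      proof (cases "x \<in> frontier \<Omega>")
        case False
        \<comment> \<open>A frontier point of the intersection lies on the frontier of \<Omega> or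
          on the circle.\<close>
        then have "x \<in> sphere 0 r"
          using x frontier_Int_subset[of \<Omega> "ball 0 r"] \<open>r > 0\<close> by (auto simp: U_def)
        then have "norm x = r" by simp
        then have "norm x \<ge> B" "norm x > R" by (auto simp: r_def)
        then show ?thesis using B[of x] ext[of x] G[of x] by simp
      qed (use G1 in simp)
    qed
    then show ?thesis using G that by simp
  qed
  have "norm (grad u z) < 1" if z: "z \<in> \<Omega>" for z
  proof (rule ccontr)
    assume "\<not> norm (grad u z) < 1"
    then have eq: "norm (cnj (grad u z)) = 1" using le1[OF z] by simp
    \<comment> \<open>An interior maximum of the modulus forces the gradient to be constant on
      \<Omega>, hence of norm 1 even at the far point \<open>x\<close> below, where it is less than
      1.\<close>
    have "(\<lambda>z. cnj (grad u z)) constant_on \<Omega>"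
      by (rule maximum_modulus_principle[OF hol \<open>open \<Omega>\<close> \<open>connected \<Omega>\<close> \<open>open \<Omega>\<close> subset_refl z])
        (use le1 eq in simp)
    then obtain c where c: "\<And>x. x \<in> \<Omega> \<Longrightarrow> cnj (grad u x) = c"
      unfolding constant_on_def by blast
    define x where "x = complex_of_real (max B (R + 1))"
    have "norm x \<ge> B" "norm x > R" using \<open>R > 0\<close> by (auto simp: x_def)
    then show False
      using B[of x] c[OF ext, of x] c[OF z] eq by (metis complex_mod_cnj less_irrefl)
  qed
  with lim show ?thesis by blast
qed

end
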